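(* Let $g\colon\mathbf{R}^n\to\mathbf{R}\cup\{+\infty\}$ be a closed convex function and $f\colon\mathbf{R}^n\to\mathbf{R}$ a $C^1$-smooth convex function with $\beta$-Lipschitz continuous gradient. Suppose that $\varphi:=f+g$ has a nonempty set $S$ of minimizers, with (finite) minimal value $\varphi^*$. Let $t>0$, $\nu>0$, and for $\alpha,\gamma>0$ consider the conditions (Quadratic growth) $\varphi(x)\ge\varphi^*+\frac{\alpha}{2}\,\mathrm{dist}^2(x;S)$ for all $x$ with $\varphi(x)\le\varphi^*+\nu$; (Error bound condition) $\mathrm{dist}(x;S)\le\gamma\|\mathcal{G}_t(x)\|$ for all $x$ with $\varphi(x)\le\varphi^*+\nu$. Then the quadratic growth condition with constant $\alpha$ implies the error bound condition with $\gamma=(2\alpha^{-1}+t)(1+\beta t)$. Conversely, the error bound condition with constant $\gamma$ implies the quadratic growth condition with any $\alpha\in(0,\gamma^{-1})$.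
   Context: $\mathrm{prox}_{tg}(x):=\operatorname{argmin}_{y}\{g(y)+\frac1{2t}\|y-x\|^2\}$, and the prox-gradient mapping is $\mathcal{G}_t(x):=t^{-1}\big(x-\mathrm{prox}_{tg}(x-t\nabla f(x))\big)$. $\mathrm{dist}(x;S)=\inf_{z\in S}\|z-x\|$. *)

theory Defs
  imports "HOL-Analysis.Analysis"
begin

text \<open>
  Functions into \<open>\<real> \<union> {+\<infinity>}\<close> are \<^typ>\<open>ereal\<close>-valued functions that never take the value
  \<open>-\<infinity>\<close>. The library's \<open>epigraph\<close> is for real-valued functions only.
\<close>

definition ereal_epigraph :: "('a \<Rightarrow> ereal) \<Rightarrow> ('a \<times> real) set" where
  "ereal_epigraph h = {(x, r). h x \<le> ereal r}"

definition closed_convex_fun :: "('a::euclidean_space \<Rightarrow> ereal) \<Rightarrow> bool" where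
  "closed_convex_fun h \<longleftrightarrow>
     (\<forall>x. h x \<noteq> - \<infinity>) \<and> closed (ereal_epigraph h) \<and> convex (ereal_epigraph h)"

definition minimizers :: "('a \<Rightarrow> ereal) \<Rightarrow> 'a set" where
  "minimizers h = {x. is_arg_min h (\<lambda>_. True) x}"

text \<open>
  \<open>arg_min\<close> selects some minimizer; for \<open>t > 0\<close> and \<open>g\<close> closed, convex and not identically
  \<open>+\<infinity>\<close> the minimizer exists and is unique.
\<close>

definition prox :: "real \<Rightarrow> ('a::euclidean_space \<Rightarrow> ereal) \<Rightarrow> 'a \<Rightarrow> 'a" where
  "prox t g x = arg_min (\<lambda>y. g y + ereal (1 / (2 * t) * (norm (y - x))\<^sup>2)) (\<lambda>_. True)"

definition prox_grad_map ::
  "('a::euclidean_space \<Rightarrow> 'a) \<Rightarrow> ('a \<Rightarrow> ereal) \<Rightarrow> real \<Rightarrow> 'a \<Rightarrow> 'a" where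
  "prox_grad_map grad_f g t x = inverse t *\<^sub>R (x - prox t g (x - t *\<^sub>R grad_f x))"

text \<open>
  In the two conditions below, \<open>infdist x S\<close> is the distance to \<open>S\<close> only when \<open>S\<close> is nonempty
  (the library sets it to \<open>0\<close> otherwise).
\<close>

definition quadratic_growth ::
  "('a::euclidean_space \<Rightarrow> ereal) \<Rightarrow> real \<Rightarrow> 'a set \<Rightarrow> real \<Rightarrow> real \<Rightarrow> bool" where
  "quadratic_growth \<phi> \<phi>_min S \<nu> \<alpha> \<longleftrightarrow>
     (\<forall>x. \<phi> x \<le> ereal (\<phi>_min + \<nu>) \<longrightarrow>
          \<phi> x \<ge> ereal (\<phi>_min + \<alpha> / 2 * (infdist x S)\<^sup>2))"

definition error_bound ::
  "('a::euclidean_space \<Rightarrow> ereal) \<Rightarrow> real \<Rightarrow> 'a set \<Rightarrow> ('a \<Rightarrow> 'a) \<Rightarrow> real \<Rightarrow> real \<Rightarrow> bool" where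
  "error_bound \<phi> \<phi>_min S G \<nu> \<gamma> \<longleftrightarrow>
     (\<forall>x. \<phi> x \<le> ereal (\<phi>_min + \<nu>) \<longrightarrow> infdist x S \<le> \<gamma> * norm (G x))"

end

theory Submission
  imports Defs
begin

text \<open>
  Write \<open>p\<close> for the prox-gradient point of \<open>x\<close> and \<open>N = norm (G x)\<close>. Then
  \<open>v = G x + grad f p - grad f x\<close> is a subgradient of \<open>\<phi>\<close> at \<open>p\<close> with
  \<open>norm v \<le> (1 + \<beta> t) N\<close>, so \<open>\<phi> p - \<phi>_min \<le> (1 + \<beta> t) N dist(p; S)\<close>.
  If \<open>\<phi> p \<le> \<phi> x\<close>, growth at \<open>p\<close> bounds \<open>dist(p; S)\<close>. For large \<open>t\<close> the point \<open>p\<close> may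
  leave the sublevel set; but then \<open>\<phi> x < \<phi> p\<close> and growth at \<open>x\<close> suffices.

  Conversely, any subgradient \<open>v\<close> of \<open>\<phi>\<close> at \<open>x\<close> satisfies \<open>norm (G x) \<le> norm v\<close>, by monotonicity of
  the subdifferential of \<open>g\<close>. Run the proximal point method on \<open>\<phi>\<close> with step \<open>s\<close>: the error bound
  makes \<open>dist(x; S)\<^sup>2 - (2 \<gamma> + s) \<phi> x\<close> nondecreasing along the iterates, and the
  distances tend to \<open>0\<close>. The choice \<open>s = 2 / \<alpha> - 2 \<gamma>\<close> gives growth with constant \<open>\<alpha>\<close>.
\<close>

section \<open>Subgradients and first-order optimality\<close>

text \<open>Finiteness at \<open>p\<close> excludes the value \<open>- \<infinity>\<close>, for
  which the inequality would be vacuous.\<close>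

definition subgradient :: "('a::real_inner \<Rightarrow> ereal) \<Rightarrow> 'a \<Rightarrow> 'a \<Rightarrow> bool" where
  "subgradient h p v \<longleftrightarrow> \<bar>h p\<bar> \<noteq> \<infinity> \<and> (\<forall>y. h p + ereal (v \<bullet> (y - p)) \<le> h y)"

lemma subgradientD_real:
  assumes "subgradient h p v" "h p = ereal a" "h y = ereal b"
  shows "a + v \<bullet> (y - p) \<le> b"
proof -
  have "h p + ereal (v \<bullet> (y - p)) \<le> h y"
    using assms(1) by (simp add: subgradient_def)
  then show ?thesis
    by (simp add: assms(2,3))
qed

lemma subgradient_monotone:
  assumes "subgradient h p v" "subgradient h q w"
  shows "0 \<le> (v - w) \<bullet> (p - q)"
proof -
  obtain a b where ab: "h p = ereal a" "h q = ereal b"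
    using assms unfolding subgradient_def by (metis ereal_real')
  have "a + v \<bullet> (q - p) \<le> b" "b + w \<bullet> (p - q) \<le> a"
    using assms ab by (auto intro: subgradientD_real)
  then show ?thesis
    by (simp add: inner_diff_left inner_diff_right)
qed

lemma gderiv_along_line:
  assumes "GDERIV h p :> D"
  shows "((\<lambda>l. h (p + l *\<^sub>R u)) has_real_derivative D \<bullet> u) (at 0)"
proof -
  have h: "(h has_derivative (\<lambda>k. k \<bullet> D)) (at (p + 0 *\<^sub>R u))"
    using assms by (simp add: gderiv_def)
  have "((\<lambda>l. p + l *\<^sub>R u) has_derivative (\<lambda>l. l *\<^sub>R u)) (at (0::real))"
    by (auto intro!: derivative_eq_intros)
  from has_derivative_compose[OF this h] show ?thesis
    by (simp add: has_field_derivative_def inner_commute mult.commute[of _ "D \<bullet> u"])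
qed

text \<open>On the segment from \<open>p\<close> to \<open>y\<close>, convexity bounds
  \<open>g\<close> by its chord, which is differentiable where \<open>g\<close> may not be. Chord
  plus \<open>h\<close> is least at \<open>p\<close>, so its slope there is nonnegative. As
  \<open>h\<close> may be nonconvex, \<open>h = - f\<close> is allowed too.\<close>

lemma subgradient_of_minimizer:
  assumes convex: "convex (ereal_epigraph g)"
    and finite: "\<bar>g p\<bar> \<noteq> \<infinity>"
    and grad: "GDERIV h p :> D"
    and min: "\<And>y. g p + ereal (h p) \<le> g y + ereal (h y)"
  shows "subgradient g p (- D)"
  unfolding subgradient_def
proof (intro conjI allI)
  fix y
  obtain a where a: "g p = ereal a"
    using finite by (metis ereal_real')
  show "g p + ereal (- D \<bullet> (y - p)) \<le> g y"
  proof (cases "g y")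
    case (real b)
    define k where "k l = l * (b - a) + h (p + l *\<^sub>R (y - p))" for l
    have k: "k 0 \<le> k l" if l: "0 \<le> l" "l \<le> 1" for l
    proof -
      have "(1 - l) *\<^sub>R (p, a) + l *\<^sub>R (y, b) \<in> ereal_epigraph g"
        by (intro convexD[OF convex]) (use a real l in \<open>auto simp: ereal_epigraph_def\<close>)
      then have "g ((1 - l) *\<^sub>R p + l *\<^sub>R y) \<le> ereal ((1 - l) * a + l * b)"
        by (simp add: ereal_epigraph_def)
      moreover have "(1 - l) *\<^sub>R p + l *\<^sub>R y = p + l *\<^sub>R (y - p)"
        by (simp add: algebra_simps)
      ultimately have "g (p + l *\<^sub>R (y - p)) \<le> ereal ((1 - l) * a + l * b)"
        by simp
      then have "g p + ereal (h p) \<le> ereal ((1 - l) * a + l * b) + ereal (h (p + l *\<^sub>R (y - p)))"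
        by (meson min add_right_mono order_trans)
      then show ?thesis
        by (simp add: a k_def algebra_simps)
    qed
    have "(k has_real_derivative (b - a) + D \<bullet> (y - p)) (at 0)"
      unfolding k_def by (auto intro!: derivative_eq_intros gderiv_along_line[OF grad])
    then have "0 \<le> (b - a) + D \<bullet> (y - p)"
    proof (rule contrapos_pp)
      assume "\<not> 0 \<le> (b - a) + D \<bullet> (y - p)"
      show "\<not> (k has_real_derivative (b - a) + D \<bullet> (y - p)) (at 0)"
      proof
        assume "(k has_real_derivative (b - a) + D \<bullet> (y - p)) (at 0)"
        from DERIV_neg_dec_right[OF this] \<open>\<not> 0 \<le> _\<close>
        obtain d where d: "d > 0" "\<And>l. 0 < l \<Longrightarrow> l < d \<Longrightarrow> k l < k 0"
          by auto
        then show False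
          using k[of "min 1 (d / 2)"] d(2)[of "min 1 (d / 2)"] by fastforce
      qed
    qed
    then show ?thesis
      by (simp add: a real)
  next
    case MInf
    then show ?thesis
      using min[of y] a by simp
  qed simp
qed (fact finite)

lemma convex_ereal_epigraph:
  assumes "convex_on UNIV f"
  shows "convex (ereal_epigraph (\<lambda>x. ereal (f x)))"
proof -
  have "ereal_epigraph (\<lambda>x. ereal (f x)) = epigraph UNIV f"
    by (auto simp: ereal_epigraph_def epigraph_def)
  then show ?thesis
    using assms convex_epigraphI by fastforce
qed

text \<open>Every point minimizes \<open>f + (- f) = 0\<close>, so the optimality condition with
  \<open>g = f\<close> and \<open>h = - f\<close> yields the gradient inequality.\<close>

lemma convex_on_gradient_le:
  assumes "convex_on UNIV f" "GDERIV f p :> D"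
  shows "f p + D \<bullet> (y - p) \<le> f y"
proof -
  have "subgradient (\<lambda>x. ereal (f x)) p (- (- D))"
    by (rule subgradient_of_minimizer[where h = "\<lambda>x. - f x"])
      (use assms convex_ereal_epigraph GDERIV_minus in auto)
  then show ?thesis
    by (auto dest: subgradientD_real)
qed

lemma subgradient_add_smooth:
  assumes "convex_on UNIV f" "GDERIV f p :> D" "subgradient g p w"
  shows "subgradient (\<lambda>x. ereal (f x) + g x) p (D + w)"
  unfolding subgradient_def
proof (intro conjI allI)
  obtain a where a: "g p = ereal a"
    using assms(3) unfolding subgradient_def by (metis ereal_real')
  then show "\<bar>ereal (f p) + g p\<bar> \<noteq> \<infinity>"
    by simp
  fix y
  have "ereal (f p + D \<bullet> (y - p)) + (g p + ereal (w \<bullet> (y - p))) \<le> ereal (f y) + g y"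
    using assms convex_on_gradient_le[OF assms(1,2)] unfolding subgradient_def
    by (intro add_mono) auto
  then show "ereal (f p) + g p + ereal ((D + w) \<bullet> (y - p)) \<le> ereal (f y) + g y"
    by (simp add: a inner_left_distrib algebra_simps)
qed

section \<open>Existence of minimizers and the proximal map\<close>

text \<open>Lower semicontinuity of \<open>g\<close> enters as closedness of its epigraph: the
  continuous function \<open>r + h y\<close> is minimized over epigraph points
  \<open>(y, r)\<close>. Coercivity of \<open>l + h\<close> bounds \<open>y\<close>; the minorant
  \<open>l\<close> bounds \<open>r\<close> from below.\<close>

lemma exists_minimizer_of_sum:
  fixes g :: "'a::euclidean_space \<Rightarrow> ereal"
  assumes closed: "closed (ereal_epigraph g)"
    and z: "g z \<noteq> \<infinity>"
    and cont: "continuous_on UNIV h" "continuous_on UNIV l"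
    and minorant: "\<And>y. ereal (l y) \<le> g y"
    and coercive: "\<And>M. bounded {y. l y + h y \<le> M}"
  obtains p where "\<bar>g p\<bar> \<noteq> \<infinity>" "\<And>y. g p + ereal (h p) \<le> g y + ereal (h y)"
proof -
  have real: "\<exists>b. g y = ereal b \<and> l y \<le> b" if "g y \<noteq> \<infinity>" for y
    using minorant[of y] that by (cases "g y") auto
  obtain c where c: "g z = ereal c"
    using real[OF z] by blast
  \<comment> \<open>\<open>M\<close> is the objective at \<open>z\<close>, so \<open>(z, c)\<close>
    lies in \<open>K\<close>, and a point with a larger value cannot beat the minimum over
    \<open>K\<close>.\<close>
  define M where "M = c + h z"
  define B where "B = {y. l y + h y \<le> M}"
  define K where "K = ereal_epigraph g \<inter> {q. snd q + h (fst q) \<le> M}"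
  have B: "compact B"
    unfolding B_def compact_eq_bounded_closed
    by (intro conjI coercive closed_Collect_le continuous_intros cont)
  have comp: "continuous_on UNIV (\<lambda>q. h (fst q))"
    by (intro continuous_on_compose2[OF cont(1)] continuous_intros) auto
  have sub: "K \<subseteq> (SIGMA y:B. {l y..M - h y})"
  proof
    fix q
    assume "q \<in> K"
    moreover obtain y r where q: "q = (y, r)"
      by fastforce
    ultimately have gr: "g y \<le> ereal r" and r: "r + h y \<le> M"
      by (auto simp: K_def ereal_epigraph_def)
    have "l y \<le> r"
      using minorant[of y] gr by (metis ereal_less_eq(3) order_trans)
    with r show "q \<in> (SIGMA y:B. {l y..M - h y})"
      by (auto simp: q B_def)
  qed
  have "compact (l ` B)" "compact ((\<lambda>y. M - h y) ` B)"
    by (intro compact_continuous_image B continuous_intros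
        continuous_on_subset[OF cont(1)] continuous_on_subset[OF cont(2)] subset_UNIV)+
  then have "bdd_below (l ` B)" "bdd_above ((\<lambda>y. M - h y) ` B)"
    by (auto intro: bounded_imp_bdd_below bounded_imp_bdd_above compact_imp_bounded)
  then obtain u v where uv: "\<And>y. y \<in> B \<Longrightarrow> u \<le> l y" "\<And>y. y \<in> B \<Longrightarrow> M - h y \<le> v"
    by (auto simp: bdd_below_def bdd_above_def)
  have "K \<subseteq> B \<times> {u..v}"
    using sub uv by fastforce
  moreover have "closed K"
    unfolding K_def
    by (intro closed_Int closed closed_Collect_le continuous_intros comp)
  ultimately have "compact K"
    by (metis B bounded_subset bounded_Times bounded_closed_interval compact_eq_bounded_closed)
  moreover have zK: "(z, c) \<in> K"
    by (simp add: K_def ereal_epigraph_def c M_def)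
  moreover have "continuous_on K (\<lambda>q. snd q + h (fst q))"
    by (intro continuous_intros continuous_on_subset[OF comp]) auto
  ultimately obtain q where q: "q \<in> K"
    and least: "\<And>q'. q' \<in> K \<Longrightarrow> snd q + h (fst q) \<le> snd q' + h (fst q')"
    using continuous_attains_inf[of K "\<lambda>q. snd q + h (fst q)"] by blast
  define p where "p = fst q"
  have gp: "g p \<le> ereal (snd q)"
    using q by (auto simp: K_def ereal_epigraph_def p_def split: prod.splits)
  then obtain a where a: "g p = ereal a" "a \<le> snd q"
    using real[of p] gp by (cases "g p") auto
  have "g p + ereal (h p) \<le> g y + ereal (h y)" for y
  proof (cases "g y = \<infinity>")
    case False
    then obtain b where b: "g y = ereal b"
      using real by blast
    have "a + h p \<le> b + h y"
    proof (cases "b + h y \<le> M")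
      case True
      then have "(y, b) \<in> K"
        by (simp add: K_def ereal_epigraph_def b)
      then show ?thesis
        using least a by (fastforce simp: p_def)
    next
      case False
      then show ?thesis
        using least[OF zK] a by (simp add: p_def M_def)
    qed
    then show ?thesis
      by (simp add: a b)
  qed simp
  then show thesis
    using that a by (metis MInfty_neq_ereal(1) PInfty_neq_ereal(1) abs_ereal.simps(1))
qed

lemma gderiv_quadratic:
  "GDERIV (\<lambda>y. 1 / (2 * t) * (norm (y - x))\<^sup>2) p :> inverse t *\<^sub>R (p - x)"
proof -
  have "((\<lambda>y. (y - x) \<bullet> (y - x)) has_derivative (\<lambda>k. 2 * (k \<bullet> (p - x)))) (at p)"
    by (auto intro!: derivative_eq_intros simp: inner_commute)
  from has_derivative_mult_right[OF this, of "1 / (2 * t)"] show ?thesis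
    by (simp add: gderiv_def power2_norm_eq_inner inverse_eq_divide)
qed

text \<open>The subgradient \<open>w\<close> is the slope of an affine minorant of \<open>g\<close>,
  which makes the prox objective coercive. Hence a minimizer exists, and first-order optimality
  applies at the one chosen by \<open>arg_min\<close>.\<close>

lemma subgradient_prox:
  fixes g :: "'a::euclidean_space \<Rightarrow> ereal"
  assumes g: "closed_convex_fun g" and w: "subgradient g z w" and t: "t > 0"
  shows "subgradient g (prox t g x) (inverse t *\<^sub>R (x - prox t g x))"
proof -
  define h where "h y = 1 / (2 * t) * (norm (y - x))\<^sup>2" for y :: 'a
  obtain c where c: "g z = ereal c"
    using w unfolding subgradient_def by (metis ereal_real')
  define e where "e = c + w \<bullet> (x - z)"
  have bounded: "bounded {y. (c + w \<bullet> (y - z)) + h y \<le> M}" for M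
  proof -
    \<comment> \<open>Beyond distance 1 the constant term is at most
      \<open>\<bar>M - e\<bar> * n\<close>; cancelling one factor \<open>n\<close> leaves the stated
      radius. The summand 1 covers the remaining points.\<close>
    have "norm (y - x) \<le> 1 + 2 * t * (\<bar>M - e\<bar> + norm w)"
      if y: "(c + w \<bullet> (y - z)) + h y \<le> M" for y
    proof (cases "norm (y - x) \<le> 1")
      case True
      moreover have "0 \<le> 2 * t * (\<bar>M - e\<bar> + norm w)"
        using t by simp
      ultimately show ?thesis
        by linarith
    next
      case False
      define n where "n = norm (y - x)"
      have n: "1 < n"
        using False by (simp add: n_def)
      have "\<bar>w \<bullet> (y - x)\<bar> \<le> norm w * n"
        unfolding n_def by (rule Cauchy_Schwarz_ineq2)
      then have "- (w \<bullet> (y - x)) \<le> norm w * n"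
        by (simp only: abs_le_iff)
      moreover have "c + w \<bullet> (y - z) = e + w \<bullet> (y - x)"
        by (simp add: e_def inner_diff_right)
      ultimately have "h y \<le> (M - e) + norm w * n"
        using y by linarith
      also have "\<dots> \<le> \<bar>M - e\<bar> * 1 + norm w * n"
        by simp
      also have "\<dots> \<le> \<bar>M - e\<bar> * n + norm w * n"
        using n by (intro add_right_mono mult_left_mono) auto
      finally have "n * n \<le> (2 * t * (\<bar>M - e\<bar> + norm w)) * n"
        using t by (simp add: h_def n_def[symmetric] field_simps power2_eq_square)
      then have "n \<le> 2 * t * (\<bar>M - e\<bar> + norm w)"
        using n by (simp add: mult_le_cancel_right)
      then show ?thesis
        by (simp add: n_def)
    qed
    then show ?thesis
      by (intro bounded_subset[OF bounded_cball[of x "1 + 2 * t * (\<bar>M - e\<bar> + norm w)"]])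
        (auto simp: dist_norm norm_minus_commute)
  qed
  obtain q where q: "\<bar>g q\<bar> \<noteq> \<infinity>" "\<And>y. g q + ereal (h q) \<le> g y + ereal (h y)"
  proof (rule exists_minimizer_of_sum[of g z h "\<lambda>y. c + w \<bullet> (y - z)"])
    show "closed (ereal_epigraph g)"
      using g by (simp add: closed_convex_fun_def)
    show "continuous_on UNIV h" "continuous_on UNIV (\<lambda>y. c + w \<bullet> (y - z))"
      unfolding h_def by (intro continuous_intros)+
    show "ereal (c + w \<bullet> (y - z)) \<le> g y" for y
      using w unfolding subgradient_def c by simp
  qed (use c bounded in auto)
  define p where "p = prox t g x"
  \<comment> \<open>The choice made by \<open>arg_min\<close> is known to be a minimizer only
    because one exists, namely \<open>q\<close>.\<close>
  have "is_arg_min (\<lambda>y. g y + ereal (h y)) (\<lambda>_. True) p"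
    unfolding p_def prox_def h_def[symmetric] arg_min_def
    by (rule someI[of _ q]) (use q in \<open>auto simp: is_arg_min_linorder\<close>)
  then have min: "g p + ereal (h p) \<le> g y + ereal (h y)" for y
    by (simp add: is_arg_min_linorder)
  have "g p \<noteq> - \<infinity>"
    using g by (simp add: closed_convex_fun_def)
  moreover have "g p \<noteq> \<infinity>"
    using min[of q] q(1) by auto
  ultimately have "subgradient g p (- (inverse t *\<^sub>R (p - x)))"
    using g min unfolding h_def
    by (intro subgradient_of_minimizer[OF _ _ gderiv_quadratic]) (auto simp: closed_convex_fun_def)
  then show ?thesis
    by (simp add: p_def algebra_simps)
qed

lemma le_mult_infdistI:
  assumes "S \<noteq> {}" "0 \<le> c" "\<And>z. z \<in> S \<Longrightarrow> a \<le> c * dist x z"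
  shows "a \<le> c * infdist x S"
proof (cases "c = 0")
  case True
  then show ?thesis
    using assms by auto
next
  case False
  then have "a / c \<le> infdist x S"
    unfolding infdist_notempty[OF assms(1)]
    by (intro cINF_greatest) (use assms in \<open>auto simp: divide_simps mult.commute\<close>)
  then show ?thesis
    using False assms(2) by (simp add: divide_simps mult.commute)
qed

section \<open>The composite problem and its prox-gradient mapping\<close>

locale composite_minimization =
  fixes f :: "'a::euclidean_space \<Rightarrow> real"
    and grad_f :: "'a \<Rightarrow> 'a"
    and g \<phi> :: "'a \<Rightarrow> ereal"
    and S :: "'a set"
    and \<phi>_min :: real
  assumes g: "closed_convex_fun g"
    and f_convex: "convex_on UNIV f"
    and f_grad: "\<And>x. GDERIV f x :> grad_f x"
    and \<phi>: "\<phi> = (\<lambda>x. ereal (f x) + g x)"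
    and S: "S = minimizers \<phi>"
    and S_nonempty: "S \<noteq> {}"
    and \<phi>_min: "(INF x. \<phi> x) = ereal \<phi>_min"
begin

lemma min_le: "ereal \<phi>_min \<le> \<phi> x"
  using INF_lower[of x UNIV \<phi>] by (simp add: \<phi>_min)

lemma minimizer_value:
  assumes "z \<in> S"
  shows "\<phi> z = ereal \<phi>_min"
proof -
  have "\<phi> z \<le> (INF x. \<phi> x)"
    using assms by (intro INF_greatest) (auto simp: S minimizers_def is_arg_min_linorder)
  then show ?thesis
    using min_le by (simp add: \<phi>_min antisym)
qed

lemma finite_g_iff: "\<bar>g x\<bar> \<noteq> \<infinity> \<longleftrightarrow> \<phi> x \<noteq> \<infinity>"
proof -
  have "g x \<noteq> - \<infinity>"
    using g by (simp add: closed_convex_fun_def)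
  then show ?thesis
    by (cases "g x") (auto simp: \<phi>)
qed

lemma real_value:
  assumes "\<phi> x \<noteq> \<infinity>"
  obtains a where "\<phi> x = ereal a" "\<phi>_min \<le> a"
proof (cases "\<phi> x")
  case (real a)
  then show ?thesis
    using that min_le[of x] by simp
qed (use assms min_le[of x] in simp_all)

text \<open>Supplies the affine minorant behind the prox map: at a minimizer \<open>z\<close> of
  \<open>\<phi>\<close>, optimality makes \<open>- grad_f z\<close> a subgradient of
  \<open>g\<close>.\<close>

lemma g_has_subgradient:
  obtains z w where "subgradient g z w"
proof -
  obtain z where z: "z \<in> S"
    using S_nonempty by blast
  have "subgradient g z (- grad_f z)"
  proof (rule subgradient_of_minimizer[OF _ _ f_grad])
    show "g z + ereal (f z) \<le> g y + ereal (f y)" for y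
      using minimizer_value[OF z] min_le[of y] by (simp add: \<phi> add.commute)
    show "\<bar>g z\<bar> \<noteq> \<infinity>"
      using minimizer_value[OF z] by (simp add: finite_g_iff)
  qed (use g in \<open>auto simp: closed_convex_fun_def\<close>)
  then show thesis
    using that by blast
qed

lemma subgradient_\<phi>:
  assumes "subgradient g p (v - grad_f p)"
  shows "subgradient \<phi> p v"
  using subgradient_add_smooth[OF f_convex f_grad[of p] assms] by (simp add: \<phi>)

text \<open>With \<open>G\<close> the mapping at \<open>x\<close>, the prox point of
  \<open>x - t *\<^sub>R grad_f x\<close> is \<open>x - t *\<^sub>R G\<close>; their difference
  divided by \<open>t\<close> is \<open>G - grad_f x\<close>.\<close>

lemma subgradient_prox_grad:
  assumes "t > 0"
  shows "subgradient g (x - t *\<^sub>R prox_grad_map grad_f g t x)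
           (prox_grad_map grad_f g t x - grad_f x)"
proof -
  obtain z w where "subgradient g z w"
    by (rule g_has_subgradient)
  from subgradient_prox[OF g this assms, of "x - t *\<^sub>R grad_f x"] show ?thesis
    using assms by (simp add: prox_grad_map_def algebra_simps)
qed

text \<open>The subgradients of \<open>g\<close> at \<open>x\<close> and at the prox-gradient point
  both contain \<open>- grad_f x\<close>, which cancels in the monotonicity inequality. What remains
  is \<open>G \<bullet> G \<le> v \<bullet> G\<close>, whatever the size of
  \<open>t\<close>.\<close>

lemma norm_prox_grad_le:
  assumes t: "t > 0" and v: "subgradient g x (v - grad_f x)"
  shows "norm (prox_grad_map grad_f g t x) \<le> norm v"
proof -
  let ?G = "prox_grad_map grad_f g t x"
  have "0 \<le> (v - ?G) \<bullet> (t *\<^sub>R ?G)"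
    using subgradient_monotone[OF v subgradient_prox_grad[OF t, of x]] by simp
  then have "?G \<bullet> ?G \<le> v \<bullet> ?G"
    using t by (simp add: inner_diff_left zero_le_mult_iff)
  also have "\<dots> \<le> norm v * norm ?G"
    by (rule norm_cauchy_schwarz)
  finally have "norm ?G * norm ?G \<le> norm v * norm ?G"
    by (simp add: power2_norm_eq_inner[symmetric] power2_eq_square)
  then show ?thesis
    by (cases "?G = 0") (auto simp: mult_le_cancel_right)
qed

text \<open>The subgradient inequality is tested at each minimizer \<open>z\<close> and combined
  with Cauchy-Schwarz before taking the infimum over \<open>S\<close>.\<close>

lemma gap_le_subgradient:
  assumes v: "subgradient \<phi> p v" and a: "\<phi> p = ereal a"
  shows "a - \<phi>_min \<le> norm v * infdist p S"
proof (rule le_mult_infdistI[OF S_nonempty])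
  fix z
  assume "z \<in> S"
  then have "a + v \<bullet> (z - p) \<le> \<phi>_min"
    using subgradientD_real[OF v a] minimizer_value by blast
  moreover have "\<bar>v \<bullet> (z - p)\<bar> \<le> norm v * dist p z"
    by (metis Cauchy_Schwarz_ineq2 dist_commute dist_norm)
  ultimately show "a - \<phi>_min \<le> norm v * dist p z"
    by linarith
qed simp

section \<open>From quadratic growth to the error bound\<close>

theorem error_bound_of_quadratic_growth:
  assumes t: "t > 0" and lipschitz: "\<beta>-lipschitz_on UNIV grad_f"
    and \<alpha>: "\<alpha> > 0" and growth: "quadratic_growth \<phi> \<phi>_min S \<nu> \<alpha>"
  shows "error_bound \<phi> \<phi>_min S (prox_grad_map grad_f g t) \<nu> ((2 * inverse \<alpha> + t) * (1 + \<beta> * t))"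
  unfolding error_bound_def
proof (intro allI impI)
  fix x
  assume x: "\<phi> x \<le> ereal (\<phi>_min + \<nu>)"
  define G where "G = prox_grad_map grad_f g t x"
  define p where "p = x - t *\<^sub>R G"
  define v where "v = G + grad_f p - grad_f x"
  define c where "c = 1 + \<beta> * t"
  define N where "N = norm G"
  define d where "d = infdist x S"
  define d' where "d' = infdist p S"
  have \<beta>: "0 \<le> \<beta>"
    using lipschitz by (rule lipschitz_on_nonneg)
  have pos: "1 \<le> c" "0 \<le> N" "0 \<le> d" "0 \<le> d'"
    using \<beta> t by (auto simp: c_def N_def d_def d'_def infdist_nonneg)
  have "subgradient g p (v - grad_f p)"
    using subgradient_prox_grad[OF t, of x] by (simp add: p_def v_def G_def)
  then have v: "subgradient \<phi> p v"
    by (rule subgradient_\<phi>)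
  then have "\<phi> p \<noteq> \<infinity>"
    by (auto simp: subgradient_def)
  then obtain a where a: "\<phi> p = ereal a" "\<phi>_min \<le> a"
    by (rule real_value)
  from x have "\<phi> x \<noteq> \<infinity>"
    by auto
  then obtain b where b: "\<phi> x = ereal b" "\<phi>_min \<le> b"
    by (rule real_value)
  have px: "dist p x = t * N"
    using t by (simp add: p_def N_def dist_norm)
  \<comment> \<open>Moving the gradient from \<open>x\<close> to \<open>p\<close> costs at most
    \<open>\<beta> * t * N\<close>, whence the factor \<open>c\<close>.\<close>
  have "norm v \<le> norm G + norm (grad_f p - grad_f x)"
    unfolding v_def by (metis add_diff_eq norm_triangle_ineq)
  also have "norm (grad_f p - grad_f x) \<le> \<beta> * dist p x"
    using lipschitz_onD[OF lipschitz, of p x] by (simp add: dist_norm)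
  finally have norm_v: "norm v \<le> c * N"
    by (simp add: px c_def N_def algebra_simps)
  have dd': "d \<le> d' + t * N"
    using infdist_triangle[of x S p] px by (simp add: d_def d'_def dist_commute)
  have d'd: "d' \<le> d + t * N"
    using infdist_triangle[of p S x] px by (simp add: d_def d'_def)
  have "a - \<phi>_min \<le> norm v * d'"
    using gap_le_subgradient[OF v a(1)] by (simp add: d'_def)
  also have "\<dots> \<le> (c * N) * d'"
    using norm_v pos by (intro mult_right_mono) auto
  finally have gap: "a - \<phi>_min \<le> (c * N) * d'" .
  have "d \<le> (2 * inverse \<alpha> + t) * c * N"
  proof (cases "a \<le> b")
    case True
    then have "\<alpha> / 2 * d'\<^sup>2 \<le> a - \<phi>_min"
      using growth[unfolded quadratic_growth_def, rule_format, of p] x a b by (simp add: d'_def)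
    with gap have "(\<alpha> / 2 * d') * d' \<le> (c * N) * d'"
      by (simp add: power2_eq_square)
    then have "\<alpha> / 2 * d' \<le> c * N"
      using pos by (cases "d' = 0") (auto simp: mult_le_cancel_right)
    then have "d' \<le> 2 * inverse \<alpha> * (c * N)"
      using \<alpha> by (simp add: field_simps)
    \<comment> \<open>As \<open>1 \<le> c\<close>, the displacement \<open>t * N\<close> fits under
      the common factor \<open>c\<close>.\<close>
    moreover have "t * N \<le> t * (c * N)"
      using t pos by (intro mult_left_mono mult_le_cancel_right1[THEN iffD2]) auto
    ultimately show ?thesis
      using dd' by (simp add: algebra_simps)
  next
    \<comment> \<open>Growth may fail to apply at \<open>p\<close>, but \<open>b < a\<close> lets
      the gap at \<open>p\<close> bound the gap at \<open>x\<close>.\<close>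
    case False
    have "\<alpha> / 2 * d\<^sup>2 \<le> b - \<phi>_min"
      using growth[unfolded quadratic_growth_def, rule_format, of x] x b by (simp add: d_def)
    also have "\<dots> \<le> (c * N) * d'"
      using gap False by linarith
    also have "\<dots> \<le> (c * N) * (d + t * N)"
      using d'd pos by (intro mult_left_mono) auto
    finally have upper: "\<alpha> / 2 * d\<^sup>2 \<le> (c * N) * (d + t * N)" .
    show ?thesis
    proof (rule ccontr)
      assume "\<not> ?thesis"
      \<comment> \<open>This is the negated claim times \<open>\<alpha> / 2\<close>. It forces
        \<open>N \<le> \<alpha> / 2 * d\<close>, and inserting that for the second \<open>N\<close>
        in \<open>upper\<close> gives the contradiction.\<close>
      then have large: "(c * N) * (1 + \<alpha> / 2 * t) < \<alpha> / 2 * d"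
        using \<alpha> by (simp add: field_simps)
      have cN: "N \<le> c * N" "0 \<le> c * N"
        using pos by (auto simp: mult_le_cancel_right1)
      have "0 \<le> (c * N) * (\<alpha> / 2 * t)"
        using cN \<alpha> t by (intro mult_nonneg_nonneg[of "c * N"]) auto
      with large have "c * N < \<alpha> / 2 * d"
        by (simp add: distrib_left)
      with cN \<alpha> have N: "N \<le> \<alpha> / 2 * d" and "0 < \<alpha> / 2 * d"
        by linarith+
      then have d: "0 < d"
        using \<alpha> by (simp add: zero_less_mult_iff)
      have "(c * N) * (d + t * N) \<le> (c * N) * (d + t * (\<alpha> / 2 * d))"
        using N cN t by (intro mult_left_mono add_left_mono) auto
      also have "\<dots> = (c * N) * (1 + \<alpha> / 2 * t) * d"
        by (simp add: algebra_simps)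
      also have "\<dots> < \<alpha> / 2 * d * d"
        using large d by (rule mult_strict_right_mono)
      finally show False
        using upper by (simp add: power2_eq_square)
    qed
  qed
  then show "infdist x S \<le> (2 * inverse \<alpha> + t) * (1 + \<beta> * t) * norm (prox_grad_map grad_f g t x)"
    by (simp add: d_def c_def N_def G_def)
qed

section \<open>Proximal point iteration and the converse\<close>

text \<open>\<open>p\<close> minimizes \<open>\<phi>\<close> plus the quadratic penalty centred at
  \<open>x\<close>. The optimality condition is stated for \<open>g\<close> so that it feeds both
  \<open>norm_prox_grad_le\<close> and \<open>subgradient_\<phi>\<close>.\<close>

lemma proximal_point_step:
  assumes s: "s > 0"
  shows "\<exists>p. subgradient g p (inverse s *\<^sub>R (x - p) - grad_f p)"
proof -
  define q where "q y = 1 / (2 * s) * (norm (y - x))\<^sup>2" for y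
  have f: "continuous_on UNIV f"
    using f_grad unfolding gderiv_def
    by (meson continuous_at_imp_continuous_on has_derivative_continuous)
  obtain z w where w: "subgradient g z w"
    by (rule g_has_subgradient)
  \<comment> \<open>With \<open>\<phi>_min - f\<close> as minorant of \<open>g\<close>, the terms in
    \<open>f\<close> cancel and only the coercive penalty remains.\<close>
  have bounded: "bounded {y. (\<phi>_min - f y) + (f y + q y) \<le> M}" for M
  proof (rule bounded_subset[OF bounded_cball[of x "1 + 2 * s * \<bar>M - \<phi>_min\<bar>"]], safe)
    fix y
    assume "\<phi>_min - f y + (f y + q y) \<le> M"
    then have "q y \<le> \<bar>M - \<phi>_min\<bar>"
      by linarith
    then have sq: "(norm (y - x))\<^sup>2 \<le> 2 * s * \<bar>M - \<phi>_min\<bar>"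
      using s by (simp add: q_def field_simps)
    have "norm (y - x) \<le> 1 + (norm (y - x))\<^sup>2"
      using zero_le_power2[of "norm (y - x) - 1 / 2"]
      by (simp add: power2_eq_square algebra_simps)
    with sq show "y \<in> cball x (1 + 2 * s * \<bar>M - \<phi>_min\<bar>)"
      by (simp add: dist_norm norm_minus_commute)
  qed
  obtain p where p: "\<bar>g p\<bar> \<noteq> \<infinity>" "\<And>y. g p + ereal (f p + q p) \<le> g y + ereal (f y + q y)"
  proof (rule exists_minimizer_of_sum[of g z "\<lambda>y. f y + q y" "\<lambda>y. \<phi>_min - f y"])
    show "closed (ereal_epigraph g)"
      using g by (simp add: closed_convex_fun_def)
    show "continuous_on UNIV (\<lambda>y. f y + q y)" "continuous_on UNIV (\<lambda>y. \<phi>_min - f y)"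
      unfolding q_def by (intro continuous_intros f)+
    show "ereal (\<phi>_min - f y) \<le> g y" for y
      using min_le[of y] unfolding \<phi> by (cases "g y") auto
    show "g z \<noteq> \<infinity>"
      using w by (auto simp: subgradient_def)
  qed (use bounded in auto)
  have "subgradient g p (- (grad_f p + inverse s *\<^sub>R (p - x)))"
    using g p unfolding q_def
    by (intro subgradient_of_minimizer[OF _ _ GDERIV_add[OF f_grad gderiv_quadratic]])
      (auto simp: closed_convex_fun_def)
  then show ?thesis
    by (auto simp: algebra_simps intro!: exI[of _ p])
qed

theorem quadratic_growth_of_error_bound:
  assumes t: "t > 0" and \<gamma>: "\<gamma> > 0" and \<alpha>: "0 < \<alpha>" "\<alpha> < inverse \<gamma>"
    and error: "error_bound \<phi> \<phi>_min S (prox_grad_map grad_f g t) \<nu> \<gamma>"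
  shows "quadratic_growth \<phi> \<phi>_min S \<nu> \<alpha>"
  unfolding quadratic_growth_def
proof (intro allI impI)
  fix x
  assume x: "\<phi> x \<le> ereal (\<phi>_min + \<nu>)"
  \<comment> \<open>Positive because \<open>\<alpha> < inverse \<gamma>\<close>, and chosen so that
    \<open>2 * \<gamma> + s = 2 / \<alpha>\<close>.\<close>
  define s where "s = 2 / \<alpha> - 2 * \<gamma>"
  have s: "0 < s"
    using \<alpha> \<gamma> by (simp add: s_def field_simps)
  obtain F where F: "\<And>y. subgradient g (F y) (inverse s *\<^sub>R (y - F y) - grad_f (F y))"
    using proximal_point_step[OF s] by metis
  define X where "X n = (F ^^ n) x" for n
  \<comment> \<open>The proximal step is implicit: \<open>V n\<close> is a subgradient of
    \<open>\<phi>\<close> at the new point \<open>X (Suc n)\<close>, not at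
    \<open>X n\<close>.\<close>
  define V where "V n = inverse s *\<^sub>R (X n - X (Suc n))" for n
  define r where "r n = real_of_ereal (\<phi> (X n))" for n
  define d where "d n = infdist (X n) S" for n
  have V: "subgradient g (X (Suc n)) (V n - grad_f (X (Suc n)))" for n
    using F[of "X n"] by (simp add: X_def V_def)
  have dist: "dist (X n) (X (Suc n)) = s * norm (V n)" for n
    using s by (simp add: V_def dist_norm)
  have finite: "\<phi> (X n) \<noteq> \<infinity>" for n
  proof (cases n)
    case 0
    then show ?thesis
      using x by (auto simp: X_def)
  next
    case (Suc m)
    then show ?thesis
      using subgradient_\<phi>[OF V[of m]] by (auto simp: subgradient_def)
  qed
  have r: "\<phi> (X n) = ereal (r n)" "\<phi>_min \<le> r n" for n
    by (rule real_value[OF finite[of n]]; simp add: r_def)+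
  have decrease: "r (Suc n) + s * (norm (V n))\<^sup>2 \<le> r n" for n
  proof -
    have "r (Suc n) + V n \<bullet> (X n - X (Suc n)) \<le> r n"
      by (rule subgradientD_real[OF subgradient_\<phi>[OF V]]) (rule r)+
    moreover have "X n - X (Suc n) = s *\<^sub>R V n"
      using s by (simp add: V_def)
    ultimately show ?thesis
      by (simp add: power2_norm_eq_inner)
  qed
  have mono: "decseq r"
    using decrease s by (intro decseq_SucI) (smt (verit) mult_nonneg_nonneg zero_le_power2)
  \<comment> \<open>Descent keeps all iterates where the error bound is assumed.\<close>
  have sublevel: "\<phi> (X n) \<le> ereal (\<phi>_min + \<nu>)" for n
    using x decseqD[OF mono, of 0 n] r(1)[of 0] r(1)[of n] by (auto simp: X_def)
  have d_le: "d (Suc n) \<le> \<gamma> * norm (V n)" for n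
  proof -
    have "d (Suc n) \<le> \<gamma> * norm (prox_grad_map grad_f g t (X (Suc n)))"
      using error sublevel unfolding error_bound_def d_def by blast
    also have "\<dots> \<le> \<gamma> * norm (V n)"
      using \<gamma> norm_prox_grad_le[OF t V[of n]] by (intro mult_left_mono) auto
    finally show ?thesis .
  qed
  have d_nonneg: "0 \<le> d n" for n
    by (simp add: d_def infdist_nonneg)
  \<comment> \<open>Expanding \<open>(d (Suc n) + s * k)\<^sup>2\<close>, the error bound turns the
    cross term into a multiple of \<open>s * k\<^sup>2\<close>, which is at most the decrease in
    \<open>r\<close>.\<close>
  have step: "(d n)\<^sup>2 - 2 / \<alpha> * r n \<le> (d (Suc n))\<^sup>2 - 2 / \<alpha> * r (Suc n)" for n
  proof -
    define k where "k = norm (V n)"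
    have "d n \<le> d (Suc n) + s * k"
      using infdist_triangle[of "X n" S "X (Suc n)"] dist by (simp add: d_def k_def)
    then have "(d n)\<^sup>2 \<le> (d (Suc n) + s * k)\<^sup>2"
      using d_nonneg by (intro power_mono)
    also have "\<dots> = (d (Suc n))\<^sup>2 + 2 * s * k * d (Suc n) + s\<^sup>2 * k\<^sup>2"
      by (simp add: power2_eq_square algebra_simps)
    also have "\<dots> \<le> (d (Suc n))\<^sup>2 + 2 * s * k * (\<gamma> * k) + s\<^sup>2 * k\<^sup>2"
      using d_le[of n] s by (intro add_mono mult_left_mono) (auto simp: k_def)
    also have "\<dots> = (d (Suc n))\<^sup>2 + (2 * \<gamma> + s) * (s * k\<^sup>2)"
      by (simp add: power2_eq_square algebra_simps)
    also have "\<dots> \<le> (d (Suc n))\<^sup>2 + (2 * \<gamma> + s) * (r n - r (Suc n))"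
      using decrease[of n] s \<gamma> by (intro add_mono mult_left_mono) (auto simp: k_def)
    also have "2 * \<gamma> + s = 2 / \<alpha>"
      by (simp add: s_def)
    finally show ?thesis
      by (simp add: algebra_simps)
  qed
  \<comment> \<open>The step inequality is chained from 0 to \<open>n\<close>; then
    \<open>\<phi>_min \<le> r n\<close> removes the last value.\<close>
  have bound: "(d 0)\<^sup>2 - 2 / \<alpha> * (r 0 - \<phi>_min) \<le> (d n)\<^sup>2" for n
  proof -
    have "(d 0)\<^sup>2 - 2 / \<alpha> * r 0 \<le> (d n)\<^sup>2 - 2 / \<alpha> * r n"
      by (induction n) (use step order_trans in blast)+
    moreover have "2 / \<alpha> * \<phi>_min \<le> 2 / \<alpha> * r n"
      using \<alpha> r(2) by (intro mult_left_mono) auto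
    ultimately show ?thesis
      by (simp add: right_diff_distrib)
  qed
  \<comment> \<open>The error bound and descent control the squared distance by a multiple of
    \<open>r n - r (Suc n)\<close>. This vanishes in the limit since \<open>r\<close> is monotone
    and bounded below; convergence of the iterates themselves is not invoked.\<close>
  have "(\<lambda>n. (d (Suc n))\<^sup>2) \<longlonglongrightarrow> 0"
  proof (rule tendsto_sandwich[where f = "\<lambda>_. 0"])
    obtain L where L: "r \<longlonglongrightarrow> L"
      using decseq_convergent[OF mono, of \<phi>_min] r(2) by blast
    then have "(\<lambda>n. \<gamma>\<^sup>2 / s * (r n - r (Suc n))) \<longlonglongrightarrow> \<gamma>\<^sup>2 / s * (L - L)"
      by (intro tendsto_intros LIMSEQ_Suc)
    then show "(\<lambda>n. \<gamma>\<^sup>2 / s * (r n - r (Suc n))) \<longlonglongrightarrow> 0"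
      by simp
    have "(d (Suc n))\<^sup>2 \<le> \<gamma>\<^sup>2 / s * (r n - r (Suc n))" for n
    proof -
      have "(d (Suc n))\<^sup>2 \<le> (\<gamma> * norm (V n))\<^sup>2"
        using d_le d_nonneg by (intro power_mono)
      also have "\<dots> = \<gamma>\<^sup>2 / s * (s * (norm (V n))\<^sup>2)"
        using s by (simp add: power_mult_distrib)
      also have "\<dots> \<le> \<gamma>\<^sup>2 / s * (r n - r (Suc n))"
        using decrease[of n] s by (intro mult_left_mono) auto
      finally show ?thesis .
    qed
    then show "\<forall>\<^sub>F n in sequentially. (d (Suc n))\<^sup>2 \<le> \<gamma>\<^sup>2 / s * (r n - r (Suc n))"
      by simp
  qed auto
  then have "(d 0)\<^sup>2 - 2 / \<alpha> * (r 0 - \<phi>_min) \<le> 0"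
    by (rule LIMSEQ_le_const) (use bound in blast)
  then have "\<phi>_min + \<alpha> / 2 * (d 0)\<^sup>2 \<le> r 0"
    using \<alpha> by (simp add: field_simps)
  then show "ereal (\<phi>_min + \<alpha> / 2 * (infdist x S)\<^sup>2) \<le> \<phi> x"
    using r(1)[of 0] by (simp add: d_def X_def)
qed

end

theorem corollary3p6:
  fixes f :: "real ^ 'n \<Rightarrow> real"
    and grad_f :: "real ^ 'n \<Rightarrow> real ^ 'n"
    and g \<phi> :: "real ^ 'n \<Rightarrow> ereal"
    and S :: "(real ^ 'n) set"
    and \<phi>_min \<beta> t \<nu> :: real
  assumes g: "closed_convex_fun g"
    and f_convex: "convex_on UNIV f"
    and f_grad: "\<And>x. GDERIV f x :> grad_f x"
    and f_C1: "continuous_on UNIV grad_f"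
    and f_lipschitz: "\<beta>-lipschitz_on UNIV grad_f"
    and \<phi>: "\<phi> = (\<lambda>x. ereal (f x) + g x)"
    and S: "S = minimizers \<phi>"
    and S_nonempty: "S \<noteq> {}"
    and \<phi>_min: "(INF x. \<phi> x) = ereal \<phi>_min"
    and t: "t > 0"
    and \<nu>: "\<nu> > 0"
  shows "(\<forall>\<alpha>>0. quadratic_growth \<phi> \<phi>_min S \<nu> \<alpha> \<longrightarrow>
            error_bound \<phi> \<phi>_min S (prox_grad_map grad_f g t) \<nu>
              ((2 * inverse \<alpha> + t) * (1 + \<beta> * t))) \<and>
         (\<forall>\<gamma>>0. error_bound \<phi> \<phi>_min S (prox_grad_map grad_f g t) \<nu> \<gamma> \<longrightarrow>
            (\<forall>\<alpha>\<in>{0<..<inverse \<gamma>}. quadratic_growth \<phi> \<phi>_min S \<nu> \<alpha>))"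
proof -
  interpret composite_minimization f grad_f g \<phi> S \<phi>_min
    using g f_convex f_grad \<phi> S S_nonempty \<phi>_min by unfold_locales
  show ?thesis
    using error_bound_of_quadratic_growth[OF t f_lipschitz] quadratic_growth_of_error_bound[OF t]
    by auto
qed

end
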